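(* Let $\beta=(\beta_L)_{L\in\mathbb{N}}$ be a sequence of integers with $\beta_L\ge 2$ for all $L$, and let $k\ge 1$. Let $\mathcal{C}\subseteq \mathbb{N}^k\setminus\{(0,\dots,0)\}$ be such that the subtraction game $\Gamma(\mathcal{P}_{\mathrm{mis}},\mathcal{C})$, where $\mathcal{P}_{\mathrm{mis}}=\mathbb{N}^k\setminus\{(0,\dots,0)\}$, is $\beta$-saturated (i.e. its Sprague–Grundy function coincides with that of $\Gamma(\mathcal{P}_{\mathrm{mis}},\mathcal{C}_{\mathrm{ord}}^{\beta})$). Then for every $X=(x^0,\dots,x^{k-1})\in\mathcal{P}_{\mathrm{mis}}$, $$\mathrm{sg}(X)=\varphi^{\beta}(X):=\big(x^0\oplus x^1\oplus\cdots\oplus x^{k-1}\big)\oplus\big(B_{\mathrm{mord}_\beta(X)+1}-1\big).$$ In particular, the Sprague–Grundy function of $\Gamma(\mathcal{P}_{\mathrm{mis}},\mathcal{C}_{\mathrm{ord}}^{\beta})$ equals $\varphi^\beta$.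
   Context: $\mathbb{N}$ denotes the nonnegative integers. Put $B_L=\beta_0\beta_1\cdots\beta_{L-1}$ (so $B_0=1$). Every $n\in\mathbb{N}$ has a unique mixed-radix expansion $n=\sum_{L} n_L B_L$ with digits $n_L\in\{0,\dots,\beta_L-1\}$. For $a,b\in\mathbb{N}$, $a\oplus b$ is the nonnegative integer whose $L$-th digit is $(a_L+b_L)\bmod \beta_L$ (digitwise addition without carry). For $n\in\mathbb{N}$, $\mathrm{ord}_\beta(n)=\min\{L: n_L\neq 0\}$ if $n\ne 0$ and $\mathrm{ord}_\beta(0)=\infty$. For $C=(c^0,\dots,c^{k-1})\in\mathbb{N}^k$, $\mathrm{mord}_\beta(C)=\min_i \mathrm{ord}_\beta(c^i)$. Define $\mathcal{C}_{\mathrm{ord}}^\beta=\{C\in\mathbb{N}^k\setminus\{0\}: \mathrm{ord}_\beta(\sum_i c^i)=\mathrm{mord}_\beta(C)\}$. For $\mathcal{P}\subseteq\mathbb{N}^k$ and $\mathcal{C}\subseteq\mathbb{N}^k\setminus\{0\}$, the subtraction game $\Gamma(\mathcal{P},\mathcal{C})$ is the digraph on vertex set $\mathcal{P}$ with an edge $X\to Y$ (i.e. $Y$ is an option of $X$) iff $X,Y\in\mathcal{P}$ and $X-Y\in\mathcal{C}$. Its Sprague–Grundy function is defined recursively by $\mathrm{sg}(X)=\mathrm{mex}\{\mathrm{sg}(Y): Y \text{ an option of } X\}$, where $\mathrm{mex}\,S=\min(\mathbb{N}\setminus S)$. $\Gamma(\mathcal{P},\mathcal{C})$ is called $\beta$-saturated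 if its Sprague–Grundy function equals that of $\Gamma(\mathcal{P},\mathcal{C}_{\mathrm{ord}}^\beta)$. *)

theory Defs
  imports Complex_Main "HOL-Library.Extended_Nat"
begin

section \<open>Mixed-radix expansions\<close>

definition radix_place :: "(nat \<Rightarrow> nat) \<Rightarrow> nat \<Rightarrow> nat" where
  "radix_place \<beta> L = (\<Prod>i<L. \<beta> i)"

definition radix_digit :: "(nat \<Rightarrow> nat) \<Rightarrow> nat \<Rightarrow> nat \<Rightarrow> nat" where
  "radix_digit \<beta> L n = (n div radix_place \<beta> L) mod \<beta> L"

lemma radix_place_0 [simp]: "radix_place \<beta> 0 = 1"
  by (simp add: radix_place_def)

lemma radix_place_Suc: "radix_place \<beta> (Suc L) = radix_place \<beta> L * \<beta> L"
  by (simp add: radix_place_def)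

lemma radix_place_dvd: "L \<le> M \<Longrightarrow> radix_place \<beta> L dvd radix_place \<beta> M"
  unfolding radix_place_def by (rule prod_dvd_prod_subset) auto

lemma radix_place_gt:
  assumes "\<And>L. \<beta> L \<ge> 2"
  shows "L < radix_place \<beta> L"
proof (induction L)
  case (Suc L)
  have "Suc L < radix_place \<beta> L * 2" using Suc by simp
  also have "\<dots> \<le> radix_place \<beta> L * \<beta> L" using assms[of L] by simp
  finally show ?case by (simp add: radix_place_Suc)
qed simp

lemma radix_digit_less:
  assumes "\<And>L. \<beta> L \<ge> 2"
  shows "radix_digit \<beta> L n < \<beta> L"
  using assms[of L] by (simp add: radix_digit_def)

lemma radix_expansion_mod:
  "(\<Sum>L<N. radix_digit \<beta> L n * radix_place \<beta> L) = n mod radix_place \<beta> N"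
proof (induction N)
  case (Suc N)
  have "n mod radix_place \<beta> (Suc N) = radix_digit \<beta> N n * radix_place \<beta> N + n mod radix_place \<beta> N"
    unfolding radix_place_Suc radix_digit_def by (metis mod_mult2_eq mult.commute)
  then show ?case by (simp only: sum.lessThan_Suc Suc add.commute)
qed simp

lemma radix_expansion:
  "n < radix_place \<beta> N \<Longrightarrow> n = (\<Sum>L<N. radix_digit \<beta> L n * radix_place \<beta> L)"
  by (simp add: radix_expansion_mod)

lemma radix_digit_eq_0:
  assumes "\<And>L. \<beta> L \<ge> 2" and "n \<le> L"
  shows "radix_digit \<beta> L n = 0"
  using radix_place_gt[of \<beta> L] assms by (simp add: radix_digit_def)

lemma radix_digit_inject:
  assumes "\<And>L. \<beta> L \<ge> 2" and "\<And>L. radix_digit \<beta> L a = radix_digit \<beta> L b"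
  shows "a = b"
proof -
  define N where "N = max a b"
  have "N < radix_place \<beta> N"
    using assms(1) by (rule radix_place_gt)
  then have "a < radix_place \<beta> N" "b < radix_place \<beta> N"
    by (simp_all add: N_def)
  moreover have "a mod radix_place \<beta> N = b mod radix_place \<beta> N"
    unfolding radix_expansion_mod[symmetric] assms(2) ..
  ultimately show ?thesis by (simp only: mod_less)
qed

lemma radix_sum_less:
  assumes "\<And>L. \<beta> L \<ge> 2" and "\<And>L. L < N \<Longrightarrow> d L < \<beta> L"
  shows "(\<Sum>L<N. d L * radix_place \<beta> L) < radix_place \<beta> N"
  using assms(2)
proof (induction N)
  case (Suc N)
  have "(\<Sum>L<Suc N. d L * radix_place \<beta> L) < (d N + 1) * radix_place \<beta> N"
    using Suc by simp
  also have "\<dots> \<le> \<beta> N * radix_place \<beta> N"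
    using Suc.prems[of N] by (intro mult_right_mono) auto
  finally show ?case by (simp add: radix_place_Suc mult.commute)
qed simp

lemma radix_digit_sum:
  assumes "\<And>L. \<beta> L \<ge> 2" and "\<And>L. L < N \<Longrightarrow> d L < \<beta> L"
  shows "radix_digit \<beta> M (\<Sum>L<N. d L * radix_place \<beta> L) = (if M < N then d M else 0)"
  using assms(2)
proof (induction N)
  case 0
  show ?case by (simp add: radix_digit_def)
next
  case (Suc N)
  let ?S = "\<Sum>L<N. d L * radix_place \<beta> L"
  have pos: "0 < radix_place \<beta> L" for L
    using radix_place_gt[of \<beta> L] assms(1) by simp
  have S: "?S < radix_place \<beta> N"
    using assms(1) Suc.prems by (intro radix_sum_less) auto
  consider "M < N" | "M = N" | "N < M" by linarith
  then show ?case
  proof cases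
    case 1
    then obtain r where "radix_place \<beta> N = radix_place \<beta> (Suc M) * r"
      using radix_place_dvd[of "Suc M" N \<beta>] by (auto elim: dvdE)
    then have "(\<Sum>L<Suc N. d L * radix_place \<beta> L) = ?S + (\<beta> M * (d N * r)) * radix_place \<beta> M"
      by (simp add: radix_place_Suc)
    moreover have "radix_digit \<beta> M (?S + (\<beta> M * (d N * r)) * radix_place \<beta> M) = radix_digit \<beta> M ?S"
      using pos[of M] by (simp add: radix_digit_def div_mult_self1 mod_mult_self4)
    ultimately have "radix_digit \<beta> M (\<Sum>L<Suc N. d L * radix_place \<beta> L) = radix_digit \<beta> M ?S"
      by (simp only:)
    with 1 Suc show ?thesis by simp
  next
    case 2
    then show ?thesis
      using pos[of N] S Suc.prems[of N] by (simp add: radix_digit_def)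
  next
    case 3
    have "radix_place \<beta> (Suc N) \<le> radix_place \<beta> M"
      using 3 radix_place_dvd[of "Suc N" M \<beta>] pos[of M] by (simp add: dvd_imp_le)
    with radix_sum_less[of \<beta> "Suc N" d] assms(1) Suc.prems
    have "(\<Sum>L<Suc N. d L * radix_place \<beta> L) < radix_place \<beta> M"
      by (meson less_le_trans)
    with 3 show ?thesis by (simp add: radix_digit_def)
  qed
qed

definition radix_add :: "(nat \<Rightarrow> nat) \<Rightarrow> nat \<Rightarrow> nat \<Rightarrow> nat" where
  "radix_add \<beta> a b =
     (THE c. \<forall>L. radix_digit \<beta> L c = (radix_digit \<beta> L a + radix_digit \<beta> L b) mod \<beta> L)"

lemma radix_digit_add:
  assumes "\<And>L. \<beta> L \<ge> 2"
  shows "radix_digit \<beta> L (radix_add \<beta> a b) = (radix_digit \<beta> L a + radix_digit \<beta> L b) mod \<beta> L"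
proof -
  define d where "d L = (radix_digit \<beta> L a + radix_digit \<beta> L b) mod \<beta> L" for L
  define c where "c = (\<Sum>L<max a b. d L * radix_place \<beta> L)"
  have "d L < \<beta> L" for L
    using assms[of L] by (simp add: d_def)
  moreover have "d L = 0" if "\<not> L < max a b" for L
    using that assms by (simp add: d_def radix_digit_eq_0)
  ultimately have c: "\<forall>L. radix_digit \<beta> L c = d L"
    using radix_digit_sum[of \<beta> "max a b" d] assms by (auto simp: c_def)
  have "\<forall>L. radix_digit \<beta> L (radix_add \<beta> a b) = d L"
    unfolding radix_add_def d_def[symmetric]
  proof (rule theI)
    show "\<forall>L. radix_digit \<beta> L c = d L" by (rule c)
    show "x = c" if "\<forall>L. radix_digit \<beta> L x = d L" for x
      using radix_digit_inject[of \<beta> x c] assms c that by simp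
  qed
  then show ?thesis by (simp add: d_def)
qed

lemma radix_add_0_right:
  assumes "\<And>L. \<beta> L \<ge> 2"
  shows "radix_add \<beta> a 0 = a"
proof (rule radix_digit_inject[of \<beta>, OF assms])
  show "radix_digit \<beta> L (radix_add \<beta> a 0) = radix_digit \<beta> L a" for L
    using radix_digit_less[of \<beta> L a] assms by (simp add: radix_digit_add radix_digit_eq_0)
qed

lemma radix_add_commute: "radix_add \<beta> a b = radix_add \<beta> b a"
  by (simp add: radix_add_def add.commute)

lemma radix_add_assoc:
  assumes "\<And>L. \<beta> L \<ge> 2"
  shows "radix_add \<beta> (radix_add \<beta> a b) c = radix_add \<beta> a (radix_add \<beta> b c)"
  by (rule radix_digit_inject[of \<beta>, OF assms]) (simp add: radix_digit_add[of \<beta>, OF assms] mod_simps add.assoc)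

text \<open>By the preceding lemmas, neither the start value \<open>0\<close> nor the order and bracketing of
  the summands matter.\<close>

definition radix_sum :: "(nat \<Rightarrow> nat) \<Rightarrow> nat list \<Rightarrow> nat" where
  "radix_sum \<beta> X = foldr (radix_add \<beta>) X 0"

definition radix_ord :: "(nat \<Rightarrow> nat) \<Rightarrow> nat \<Rightarrow> enat" where
  "radix_ord \<beta> n = (if n = 0 then \<infinity> else enat (LEAST L. radix_digit \<beta> L n \<noteq> 0))"

section \<open>Tuples\<close>

text \<open>Elements of \<open>\<nat>\<^sup>k\<close> are lists of length \<open>k\<close>.\<close>

definition tuples :: "nat \<Rightarrow> nat list set" where
  "tuples k = {X. length X = k}"

definition nonzero_tuples :: "nat \<Rightarrow> nat list set" where
  "nonzero_tuples k = tuples k - {replicate k 0}"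

definition radix_mord :: "(nat \<Rightarrow> nat) \<Rightarrow> nat list \<Rightarrow> enat" where
  "radix_mord \<beta> C = Min (radix_ord \<beta> ` set C)"

definition C_ord :: "(nat \<Rightarrow> nat) \<Rightarrow> nat \<Rightarrow> nat list set" where
  "C_ord \<beta> k = {C \<in> nonzero_tuples k. radix_ord \<beta> (sum_list C) = radix_mord \<beta> C}"

section \<open>Subtraction games and the Sprague--Grundy function\<close>

text \<open>The game is represented by its edge relation. The condition \<open>list_all2 (\<le>) Y X\<close> is needed because
  subtraction on \<^typ>\<open>nat\<close> truncates; it holds automatically if the difference is
  taken in the integers and lies in a set of tuples of natural numbers.\<close>

definition subtraction_game :: "nat list set \<Rightarrow> nat list set \<Rightarrow> (nat list \<times> nat list) set" where
  "subtraction_game P C =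
     {(X, Y). X \<in> P \<and> Y \<in> P \<and> list_all2 (\<le>) Y X \<and> map2 (-) X Y \<in> C}"

definition mex :: "nat set \<Rightarrow> nat" where
  "mex S = (LEAST n. n \<notin> S)"

definition sg :: "('a \<times> 'a) set \<Rightarrow> 'a \<Rightarrow> nat" where
  "sg E = wfrec (E\<inverse>) (\<lambda>f X. mex (f ` {Y. (X, Y) \<in> E}))"

lemma sg_rec:
  assumes "wf (E\<inverse>)"
  shows "sg E X = mex (sg E ` {Y. (X, Y) \<in> E})"
proof -
  have "sg E X = mex (cut (sg E) (E\<inverse>) X ` {Y. (X, Y) \<in> E})"
    unfolding sg_def by (subst wfrec[OF assms]) simp
  also have "cut (sg E) (E\<inverse>) X ` {Y. (X, Y) \<in> E} = sg E ` {Y. (X, Y) \<in> E}"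
    by (intro image_cong) (auto simp: cut_apply)
  finally show ?thesis .
qed

lemma sum_list_list_all2_less:
  assumes "list_all2 (\<le>) Y X" and "Y \<noteq> X"
  shows "sum_list Y < sum_list (X :: nat list)"
proof -
  have le: "list_all2 (\<le>) Y X \<Longrightarrow> sum_list Y \<le> sum_list X" for X Y :: "nat list"
    by (induction rule: list_all2_induct) auto
  show ?thesis
    using assms
  proof (induction rule: list_all2_induct)
    case (Cons y Y x X)
    then show ?case using le[of Y X] by (cases "Y = X") auto
  qed simp
qed

lemma wf_subtraction_game:
  assumes "C \<subseteq> nonzero_tuples k"
  shows "wf ((subtraction_game P C)\<inverse>)"
proof (rule wf_subset[OF wf_measure[of sum_list]], clarify)
  fix X Y assume "(X, Y) \<in> subtraction_game P C"
  then have le: "list_all2 (\<le>) Y X" and "map2 (-) X Y \<in> nonzero_tuples k"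
    using assms by (auto simp: subtraction_game_def)
  moreover have "map2 (-) X X = replicate (length X) (0::nat)" for X
    by (induction X) auto
  ultimately have "Y \<noteq> X"
    by (auto simp: nonzero_tuples_def tuples_def)
  with le show "(Y, X) \<in> measure sum_list"
    by (simp add: sum_list_list_all2_less)
qed

definition saturated :: "(nat \<Rightarrow> nat) \<Rightarrow> nat \<Rightarrow> nat list set \<Rightarrow> nat list set \<Rightarrow> bool" where
  "saturated \<beta> k P C \<longleftrightarrow>
     (\<forall>X\<in>P. sg (subtraction_game P C) X = sg (subtraction_game P (C_ord \<beta> k)) X)"

abbreviation P_mis :: "nat \<Rightarrow> nat list set" where
  "P_mis k \<equiv> nonzero_tuples k"

definition \<phi> :: "(nat \<Rightarrow> nat) \<Rightarrow> nat list \<Rightarrow> nat" where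
  "\<phi> \<beta> X =
     radix_add \<beta> (radix_sum \<beta> X) (radix_place \<beta> (the_enat (radix_mord \<beta> X) + 1) - 1)"

end

theory Submission
  imports Defs
begin

text \<open>Write \<open>S\<^sub>L(X)\<close> for the sum of the \<open>L\<close>-th digits of the entries of \<open>X\<close>. For nonzero \<open>X\<close>, the
  \<open>L\<close>-th digit of \<open>\<phi>(X)\<close> is \<open>S\<^sub>L(X) - 1\<close> or \<open>S\<^sub>L(X)\<close> modulo \<open>\<beta>\<^sub>L\<close>, according to whether \<open>B\<^sub>L\<close> divides
  every entry of \<open>X\<close> or not. A move subtracting \<open>C\<close> with \<open>mord C = M\<close> keeps all digits below \<open>M\<close>, hence
  the case distinction at \<open>M\<close>, but changes \<open>S\<^sub>M\<close> modulo \<open>\<beta>\<^sub>M\<close>; so it changes \<open>\<phi>\<close>.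

  Conversely let \<open>h < \<phi>(X)\<close>, and let \<open>M\<close> and \<open>N\<close> be the lowest and the highest position at which
  \<open>h\<close> and \<open>\<phi>(X)\<close> differ. Any nonzero \<open>Y \<le> X\<close> with \<open>\<phi>(Y) = h\<close> that agrees with \<open>X\<close> below \<open>M\<close> is an
  option of \<open>X\<close>. Such a \<open>Y\<close> is obtained by prescribing its digit sums: if \<open>mord X < M\<close>, those
  of \<open>X\<close> below \<open>M\<close> and the digits of \<open>h\<close> from \<open>M\<close> on; otherwise the digits of \<open>h + 1\<close>, where \<open>Y\<close> must
  also satisfy \<open>mord Y = ord (h + 1)\<close>.\<close>

abbreviation digit_sum :: "(nat \<Rightarrow> nat) \<Rightarrow> nat \<Rightarrow> nat list \<Rightarrow> nat" where
  "digit_sum \<beta> L X \<equiv> (\<Sum>x\<leftarrow>X. radix_digit \<beta> L x)"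

abbreviation place_dvd :: "(nat \<Rightarrow> nat) \<Rightarrow> nat \<Rightarrow> nat list \<Rightarrow> bool" where
  "place_dvd \<beta> L X \<equiv> (\<forall>x\<in>set X. radix_place \<beta> L dvd x)"

section \<open>Sums, residues and extended naturals\<close>

text \<open>Greedy choice: the last summand gives up as much of \<open>d\<close> as it can, the
  induction hypothesis handles the rest. Serves to lower the digits at one position of a tuple by
  \<open>d\<close> in total.\<close>

lemma ex_smaller_summands:
  fixes s :: "nat \<Rightarrow> nat"
  assumes "d \<le> (\<Sum>j<k. s j)"
  shows "\<exists>t. (\<forall>j<k. t j \<le> s j) \<and> (\<Sum>j<k. t j) + d = (\<Sum>j<k. s j)"
  using assms
proof (induction k arbitrary: d)
  case 0
  then show ?case by simp
next
  case (Suc k)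
  define e where "e = min d (s k)"
  have "d - e \<le> (\<Sum>j<k. s j)"
    using Suc.prems by (auto simp: e_def min_def)
  from Suc.IH[OF this] obtain t where t: "\<And>j. j < k \<Longrightarrow> t j \<le> s j"
      "(\<Sum>j<k. t j) + (d - e) = (\<Sum>j<k. s j)" by blast
  have "(\<Sum>j<k. (t(k := s k - e)) j) = (\<Sum>j<k. t j)" by (rule sum.cong) auto
  then show ?case using t
    by (intro exI[of _ "t(k := s k - e)"]) (auto simp: e_def less_Suc_eq)
qed

lemma add_mod_right_cancel:
  "(a + c) mod n = (b + c) mod n \<longleftrightarrow> a mod n = b mod n" for a b c n :: nat
proof -
  have "a + c + n * p = b + c + n * q \<longleftrightarrow> a + n * p = b + n * q" for p q by linarith
  then show ?thesis by (simp only: nat_mod_eq_iff)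
qed

lemma dvd_sum_list:
  fixes a :: "'a :: comm_semiring_1"
  assumes "\<forall>x\<in>set xs. a dvd x"
  shows "a dvd sum_list xs"
  using assms by (induction xs) auto

text \<open>Lets an equality of \<open>radix_ord\<close> and \<open>radix_mord\<close> be checked
  through divisibility by places.\<close>

lemma enat_eqI:
  assumes "\<And>L. enat L \<le> a \<longleftrightarrow> enat L \<le> b"
  shows "a = b"
proof -
  have "x \<le> y" if le: "\<And>L. enat L \<le> x \<Longrightarrow> enat L \<le> y" for x y
  proof (cases x)
    case (enat n)
    then show ?thesis using le[of n] by simp
  next
    case infinity
    then show ?thesis using le[of "Suc (the_enat y)"] by (cases y) auto
  qed
  from this[of a b] this[of b a] assms show ?thesis by simp
qed

context
  fixes \<beta> :: "nat \<Rightarrow> nat"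
  assumes base_ge_2: "\<And>L. \<beta> L \<ge> 2"
begin

section \<open>Digits, divisibility and comparison of numbers\<close>

lemma radix_place_pos: "0 < radix_place \<beta> L"
  using radix_place_gt[of \<beta> L] base_ge_2 by simp

lemma radix_digit_lt [simp]: "radix_digit \<beta> L n < \<beta> L"
  using radix_digit_less base_ge_2 by blast

lemma radix_place_Suc_dvd_iff:
  "radix_place \<beta> (Suc L) dvd n \<longleftrightarrow> radix_place \<beta> L dvd n \<and> radix_digit \<beta> L n = 0"
proof -
  have "radix_place \<beta> L dvd n" if "radix_place \<beta> (Suc L) dvd n"
    using that radix_place_Suc by (metis dvd_mult_left)
  moreover have "radix_place \<beta> (Suc L) dvd n \<longleftrightarrow> radix_digit \<beta> L n = 0" if "radix_place \<beta> L dvd n"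
    using that radix_place_pos[of L] by (auto simp: radix_place_Suc radix_digit_def elim!: dvdE)
  ultimately show ?thesis by blast
qed

lemma radix_place_dvd_iff: "radix_place \<beta> L dvd n \<longleftrightarrow> (\<forall>l<L. radix_digit \<beta> l n = 0)"
  by (induction L) (auto simp: radix_place_Suc_dvd_iff less_Suc_eq)

lemma radix_digit_Suc:
  "radix_digit \<beta> L (Suc n) =
    (radix_digit \<beta> L n + (if radix_place \<beta> L dvd Suc n then 1 else 0)) mod \<beta> L"
  by (auto simp: radix_digit_def div_Suc mod_simps dvd_eq_mod_eq_0)

text \<open>Divisibility of \<open>Suc n\<close> means that the carry of \<open>n + 1\<close> gets
  as far as position \<open>L\<close>, which takes maximal digits all the way below.\<close>

lemma radix_place_dvd_Suc_iff:
  "radix_place \<beta> L dvd Suc n \<longleftrightarrow> (\<forall>l<L. radix_digit \<beta> l n = \<beta> l - 1)"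
proof (induction L)
  case (Suc L)
  have "radix_digit \<beta> L (Suc n) = 0 \<longleftrightarrow> radix_digit \<beta> L n = \<beta> L - 1"
    if "radix_place \<beta> L dvd Suc n"
  proof (cases "radix_digit \<beta> L n = \<beta> L - 1")
    case True
    then show ?thesis using that base_ge_2[of L] by (simp add: radix_digit_Suc)
  next
    case False
    then have "Suc (radix_digit \<beta> L n) < \<beta> L"
      using radix_digit_lt[of L n] by linarith
    then show ?thesis using that False by (simp add: radix_digit_Suc)
  qed
  then show ?case using Suc by (auto simp: radix_place_Suc_dvd_iff less_Suc_eq)
qed simp

text \<open>Adding this number without carry lowers each digit below \<open>M\<close> by 1 modulo
  its base; this is how it enters \<open>\<phi>\<close>.\<close>

lemma radix_digit_place_minus_1:
  "radix_digit \<beta> L (radix_place \<beta> M - 1) = (if L < M then \<beta> L - 1 else 0)"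
proof (cases "L < M")
  case True
  then show ?thesis
    using radix_place_dvd_Suc_iff[of M "radix_place \<beta> M - 1"] radix_place_pos[of M] by simp
next
  case False
  then have "radix_place \<beta> M - 1 < radix_place \<beta> L"
    using dvd_imp_le[OF radix_place_dvd[of M L \<beta>] radix_place_pos[of L]] radix_place_pos[of M]
    by simp
  with False show ?thesis by (simp add: radix_digit_def)
qed

lemma ex_radix_digits:
  assumes "\<And>L. d L < \<beta> L" "\<And>L. K \<le> L \<Longrightarrow> d L = 0"
  shows "\<exists>n. \<forall>L. radix_digit \<beta> L n = d L"
  using radix_digit_sum[of \<beta> K d] assms base_ge_2
  by (intro exI[of _ "\<Sum>L<K. d L * radix_place \<beta> L"]) auto

lemma radix_mod_eq_iff:
  "a mod radix_place \<beta> N = b mod radix_place \<beta> N \<longleftrightarrow>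
    (\<forall>L<N. radix_digit \<beta> L a = radix_digit \<beta> L b)"
proof (induction N)
  case (Suc N)
  have eq: "n mod radix_place \<beta> (Suc N) =
      radix_place \<beta> N * radix_digit \<beta> N n + n mod radix_place \<beta> N" for n
    by (simp add: radix_place_Suc radix_digit_def mod_mult2_eq)
  have "a mod radix_place \<beta> (Suc N) = b mod radix_place \<beta> (Suc N) \<longleftrightarrow>
    a mod radix_place \<beta> N = b mod radix_place \<beta> N \<and> radix_digit \<beta> N a = radix_digit \<beta> N b"
    (is "?l \<longleftrightarrow> ?r")
  proof
    assume ?l
    then have m: "a mod radix_place \<beta> N = b mod radix_place \<beta> N"
      by (metis dvd_refl le_SucI mod_mod_cancel order_refl radix_place_dvd)
    with \<open>?l\<close> show ?r unfolding eq using radix_place_pos[of N] by auto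
  qed (simp add: eq)
  then show ?case using Suc by (auto simp: less_Suc_eq)
qed simp

text \<open>All positions below \<open>N\<close> together contribute less than
  \<open>radix_place \<beta> N\<close>, so one unit at \<open>N\<close> outweighs them.\<close>

lemma radix_less:
  assumes "radix_digit \<beta> N a < radix_digit \<beta> N b"
    "\<And>L. N < L \<Longrightarrow> radix_digit \<beta> L a = radix_digit \<beta> L b"
  shows "a < b"
proof -
  \<comment> \<open>\<open>K\<close> lies above \<open>N\<close>, and
    \<open>radix_place \<beta> K\<close> exceeds \<open>K\<close>, so both expansions end below
    position \<open>K\<close>.\<close>
  define K where "K = Suc (max N (max a b))"
  have "max a b < radix_place \<beta> K"
    using radix_place_gt[of \<beta> K] base_ge_2 by (auto simp: K_def)
  then have K: "a = (\<Sum>L<K. radix_digit \<beta> L a * radix_place \<beta> L)"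
      "b = (\<Sum>L<K. radix_digit \<beta> L b * radix_place \<beta> L)"
    by (auto intro!: radix_expansion)
  have split: "(\<Sum>L<K. f L) = (\<Sum>L<N. f L) + f N + (\<Sum>L\<in>{Suc N..<K}. f L)" for f :: "nat \<Rightarrow> nat"
  proof -
    have "N < K" by (simp add: K_def)
    then show ?thesis
      using sum.atLeastLessThan_concat[of 0 N K f] sum.atLeast_Suc_lessThan[of N K f]
      by (simp add: lessThan_atLeast0 add.assoc)
  qed
  have "(\<Sum>L<N. radix_digit \<beta> L a * radix_place \<beta> L) < radix_place \<beta> N"
    by (rule radix_sum_less) (auto simp: base_ge_2)
  moreover have "(radix_digit \<beta> N a + 1) * radix_place \<beta> N \<le> radix_digit \<beta> N b * radix_place \<beta> N"
    using assms(1) by (intro mult_right_mono) auto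
  moreover have "(\<Sum>L\<in>{Suc N..<K}. radix_digit \<beta> L a * radix_place \<beta> L) =
      (\<Sum>L\<in>{Suc N..<K}. radix_digit \<beta> L b * radix_place \<beta> L)"
    by (rule sum.cong) (auto simp: assms(2))
  ultimately show ?thesis
    by (subst K(1), subst K(2), simp only: split) simp
qed

lemma ex_top_difference:
  assumes "a < b"
  shows "\<exists>N. radix_digit \<beta> N a < radix_digit \<beta> N b \<and>
    (\<forall>L>N. radix_digit \<beta> L a = radix_digit \<beta> L b)"
proof -
  define D where "D = {L. radix_digit \<beta> L a \<noteq> radix_digit \<beta> L b}"
  have "radix_digit \<beta> L a = radix_digit \<beta> L b" if "b < L" for L
    using that assms base_ge_2 by (simp add: radix_digit_eq_0)
  then have "D \<subseteq> {..b}"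
    by (auto simp: D_def not_less[symmetric])
  then have fin: "finite D" by (rule finite_subset) simp
  have "D \<noteq> {}"
    using assms radix_digit_inject[of \<beta> a b] base_ge_2 by (auto simp: D_def)
  define N where "N = Max D"
  have N: "N \<in> D" "\<And>L. N < L \<Longrightarrow> L \<notin> D"
    using fin \<open>D \<noteq> {}\<close> by (auto simp: N_def)
  have "\<not> radix_digit \<beta> N b < radix_digit \<beta> N a"
    using radix_less[of N b a] N(2) assms by (auto simp: D_def)
  with N show ?thesis by (auto simp: D_def intro!: exI[of _ N])
qed

lemma radix_le:
  assumes "\<And>L. radix_digit \<beta> L a \<le> radix_digit \<beta> L b"
  shows "a \<le> b"
  using ex_top_difference[of b a] assms by (metis leD leI)

section \<open>Digit sums, orders and the digits of \<open>\<phi>\<close>\<close>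

lemma radix_digit_radix_sum: "radix_digit \<beta> L (radix_sum \<beta> X) = digit_sum \<beta> L X mod \<beta> L"
proof (induction X)
  case Nil
  then show ?case by (simp add: radix_sum_def radix_digit_def)
next
  case (Cons x X)
  then show ?case
    by (simp add: radix_sum_def radix_digit_add[OF base_ge_2] mod_simps)
qed

text \<open>Trades the minimum in \<open>radix_ord\<close> for divisibility, which also fits
  \<open>n = 0\<close>: the order is infinite and every place divides.\<close>

lemma radix_ord_ge_iff: "enat L \<le> radix_ord \<beta> n \<longleftrightarrow> radix_place \<beta> L dvd n"
proof (cases "n = 0")
  case False
  have ex: "\<exists>l. radix_digit \<beta> l n \<noteq> 0"
    using False radix_digit_inject[of \<beta> n 0] base_ge_2 by (metis le0 radix_digit_eq_0)
  have "L \<le> (LEAST l. radix_digit \<beta> l n \<noteq> 0) \<longleftrightarrow> (\<forall>l<L. radix_digit \<beta> l n = 0)"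
    using LeastI_ex[OF ex] not_less_Least[of _ "\<lambda>l. radix_digit \<beta> l n \<noteq> 0"]
    by (metis (lifting) leD leI order.strict_trans2)
  then show ?thesis using False by (simp add: radix_ord_def radix_place_dvd_iff)
qed (simp add: radix_ord_def)

lemma radix_mord_ge_iff:
  assumes "X \<noteq> []"
  shows "enat L \<le> radix_mord \<beta> X \<longleftrightarrow> place_dvd \<beta> L X"
  using assms by (simp add: radix_mord_def radix_ord_ge_iff)

text \<open>Position \<open>x\<close> is high enough because
  \<open>radix_place \<beta> x > x\<close>; this makes the order of a nonzero tuple finite.\<close>

lemma not_place_dvd_large:
  assumes "x \<in> set X" "x \<noteq> 0"
  shows "\<not> place_dvd \<beta> x X"
proof
  assume "place_dvd \<beta> x X"
  then have "radix_place \<beta> x \<le> x"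
    using assms by (intro dvd_imp_le) auto
  then show False
    using radix_place_gt[of \<beta> x] base_ge_2 by simp
qed

lemma nonzero_tuplesD:
  assumes "X \<in> nonzero_tuples k"
  shows "length X = k" "X \<noteq> []" "\<exists>x\<in>set X. x \<noteq> 0"
proof -
  show len: "length X = k"
    using assms by (simp add: nonzero_tuples_def tuples_def)
  have "X \<noteq> replicate k 0"
    using assms by (simp add: nonzero_tuples_def)
  then show ex: "\<exists>x\<in>set X. x \<noteq> 0"
    using len by (metis replicate_eqI)
  then show "X \<noteq> []" by auto
qed

lemma nonzero_tuplesI:
  assumes "length X = k" "\<not> place_dvd \<beta> L X"
  shows "X \<in> nonzero_tuples k"
  using assms by (auto simp: nonzero_tuples_def tuples_def simp del: replicate_length_same)
    (metis dvd_0_right in_set_replicate)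

lemma place_dvd_antimono:
  assumes "L \<le> M" "place_dvd \<beta> M X"
  shows "place_dvd \<beta> L X"
  using assms(2) dvd_trans[OF radix_place_dvd[OF assms(1)]] by blast

lemma ex_last_place_dvd:
  assumes "X \<in> nonzero_tuples k"
  shows "\<exists>m. radix_mord \<beta> X = enat m \<and> (\<forall>L. place_dvd \<beta> L X \<longleftrightarrow> L \<le> m)"
proof -
  obtain x where x: "x \<in> set X" "x \<noteq> 0" using nonzero_tuplesD[OF assms] by blast
  have "radix_mord \<beta> X \<noteq> \<infinity>"
    using not_place_dvd_large[OF x] radix_mord_ge_iff[of X x] x by (metis enat_ord_code(3) nonzero_tuplesD(2) assms)
  then obtain m where m: "radix_mord \<beta> X = enat m" by auto
  then show ?thesis
    using radix_mord_ge_iff[OF nonzero_tuplesD(2)[OF assms]] by (metis enat_ord_simps(1))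
qed

text \<open>With \<open>m\<close> the order of \<open>X\<close>, the number
  \<open>radix_place \<beta> (m + 1) - 1\<close> has maximal digits exactly at
  \<open>L \<le> m\<close>, that is, where the place divides all entries. The \<open>+ 1\<close>
  includes position \<open>m\<close> itself.\<close>

lemma radix_digit_phi:
  assumes "X \<in> nonzero_tuples k"
  shows "radix_digit \<beta> L (\<phi> \<beta> X) =
    (digit_sum \<beta> L X + (if place_dvd \<beta> L X then \<beta> L - 1 else 0)) mod \<beta> L"
proof -
  obtain m where m: "radix_mord \<beta> X = enat m" "place_dvd \<beta> L X \<longleftrightarrow> L \<le> m"
    using ex_last_place_dvd[OF assms] by blast
  show ?thesis unfolding m(2)
    by (simp add: \<phi>_def m(1) radix_digit_add[OF base_ge_2] radix_digit_radix_sum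
        radix_digit_place_minus_1 less_Suc_eq_le mod_simps del: One_nat_def)
qed

lemma C_ord_iff:
  "C \<in> C_ord \<beta> k \<longleftrightarrow> C \<in> nonzero_tuples k \<and>
    (\<forall>L. radix_place \<beta> L dvd sum_list C \<longleftrightarrow> place_dvd \<beta> L C)"
proof (cases "C \<in> nonzero_tuples k")
  case True
  have "radix_ord \<beta> (sum_list C) = radix_mord \<beta> C \<longleftrightarrow>
      (\<forall>L. enat L \<le> radix_ord \<beta> (sum_list C) \<longleftrightarrow> enat L \<le> radix_mord \<beta> C)"
    using enat_eqI by metis
  then show ?thesis
    using True
    by (simp add: C_ord_def radix_mord_ge_iff[OF nonzero_tuplesD(2)[OF True]] radix_ord_ge_iff)
qed (simp add: C_ord_def)

section \<open>Effect of a move on the digits of \<open>\<phi>\<close>\<close>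

text \<open>When \<open>radix_place \<beta> M\<close> divides every difference, no borrow enters
  position \<open>M\<close>, so the digits there simply add up modulo
  \<open>\<beta> M\<close>.\<close>

lemma digit_sum_diff:
  assumes "list_all2 (\<le>) Y X" "place_dvd \<beta> M (map2 (-) X Y)"
  shows "digit_sum \<beta> M X mod \<beta> M =
    (digit_sum \<beta> M Y + radix_digit \<beta> M (sum_list (map2 (-) X Y))) mod \<beta> M"
  using assms
proof (induction rule: list_all2_induct)
  case Nil
  then show ?case by (simp add: radix_digit_def)
next
  case (Cons y Y x X)
  let ?c = "x - y" and ?C = "sum_list (map2 (-) X Y)"
  have add: "radix_digit \<beta> M (a + b) = (radix_digit \<beta> M a + radix_digit \<beta> M b) mod \<beta> M"
    if "radix_place \<beta> M dvd a" for a b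
    using that by (simp add: radix_digit_def div_plus_div_distrib_dvd_left mod_simps)
  have c: "radix_place \<beta> M dvd ?c" using Cons.prems by simp
  have x: "radix_digit \<beta> M x = (radix_digit \<beta> M ?c + radix_digit \<beta> M y) mod \<beta> M"
    using add[OF c, of y] Cons.hyps by simp
  have IH: "digit_sum \<beta> M X mod \<beta> M = (digit_sum \<beta> M Y + radix_digit \<beta> M ?C) mod \<beta> M"
    using Cons by simp
  have "digit_sum \<beta> M (x # X) mod \<beta> M = (radix_digit \<beta> M x + digit_sum \<beta> M X mod \<beta> M) mod \<beta> M"
    by (simp add: mod_simps)
  also have "\<dots> = (radix_digit \<beta> M y + digit_sum \<beta> M Y + (radix_digit \<beta> M ?c + radix_digit \<beta> M ?C)) mod \<beta> M"
    unfolding IH x by (subst mod_add_eq) (simp add: add_ac)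
  also have "\<dots> = (radix_digit \<beta> M y + digit_sum \<beta> M Y + radix_digit \<beta> M (?c + ?C)) mod \<beta> M"
    unfolding add[OF c] by (simp add: mod_simps)
  finally show ?case by simp
qed

lemma place_dvd_cong:
  assumes "length X = length Y" "L \<le> M"
    "\<And>j l. j < length X \<Longrightarrow> l < M \<Longrightarrow> radix_digit \<beta> l (Y ! j) = radix_digit \<beta> l (X ! j)"
  shows "place_dvd \<beta> L X \<longleftrightarrow> place_dvd \<beta> L Y"
proof -
  have "radix_place \<beta> L dvd Y ! j \<longleftrightarrow> radix_place \<beta> L dvd X ! j" if "j < length X" for j
    using assms(3)[OF that less_le_trans[OF _ assms(2)]] by (simp add: radix_place_dvd_iff)
  then show ?thesis
    using assms(1) by (simp add: all_set_conv_all_nth)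
qed

text \<open>Subtraction is exact because \<open>Y\<close> lies below \<open>X\<close>, so
  divisibility of a difference is congruence modulo the place.\<close>

lemma place_dvd_diff_iff:
  assumes "list_all2 (\<le>) Y X"
  shows "place_dvd \<beta> M (map2 (-) X Y) \<longleftrightarrow>
    (\<forall>j<length X. \<forall>l<M. radix_digit \<beta> l (Y ! j) = radix_digit \<beta> l (X ! j))"
proof -
  have "radix_place \<beta> M dvd x - y \<longleftrightarrow> (\<forall>l<M. radix_digit \<beta> l y = radix_digit \<beta> l x)"
    if "y \<le> x" for x y
    using that radix_mod_eq_iff[of y M x] mod_eq_dvd_iff_nat[of y x "radix_place \<beta> M"] by metis
  then show ?thesis
    using assms by (auto simp: all_set_conv_all_nth list_all2_conv_all_nth)
qed

text \<open>\<open>X\<close> and \<open>Y\<close> agree below \<open>M\<close>, so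
  \<open>\<phi>\<close> adds the same offset at \<open>M\<close> to both. Once it is cancelled, the
  digit sums differ by digit \<open>M\<close> of the subtracted total.\<close>

lemma digit_phi_eq_iff:
  assumes "X \<in> nonzero_tuples k" "Y \<in> nonzero_tuples k" "list_all2 (\<le>) Y X"
    "place_dvd \<beta> M (map2 (-) X Y)"
  shows "radix_digit \<beta> M (\<phi> \<beta> X) = radix_digit \<beta> M (\<phi> \<beta> Y) \<longleftrightarrow>
    radix_place \<beta> (Suc M) dvd sum_list (map2 (-) X Y)"
proof -
  let ?C = "sum_list (map2 (-) X Y)" and ?e = "if place_dvd \<beta> M Y then \<beta> M - 1 else 0"
  have same: "place_dvd \<beta> M X \<longleftrightarrow> place_dvd \<beta> M Y"
    using assms place_dvd_diff_iff[OF assms(3)]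
    by (intro place_dvd_cong[of _ _ _ M]) (auto simp: list_all2_lengthD)
  have dvd: "radix_place \<beta> M dvd ?C"
    using assms(4) by (rule dvd_sum_list)
  have "radix_digit \<beta> M (\<phi> \<beta> X) = radix_digit \<beta> M (\<phi> \<beta> Y) \<longleftrightarrow>
      (digit_sum \<beta> M X + ?e) mod \<beta> M = (digit_sum \<beta> M Y + ?e) mod \<beta> M"
    by (simp only: radix_digit_phi[OF assms(1)] radix_digit_phi[OF assms(2)] same)
  also have "\<dots> \<longleftrightarrow> digit_sum \<beta> M X mod \<beta> M = digit_sum \<beta> M Y mod \<beta> M"
    by (rule add_mod_right_cancel)
  also have "\<dots> \<longleftrightarrow> (radix_digit \<beta> M ?C + digit_sum \<beta> M Y) mod \<beta> M = (0 + digit_sum \<beta> M Y) mod \<beta> M"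
    unfolding digit_sum_diff[OF assms(3,4)] by (simp add: add.commute)
  also have "\<dots> \<longleftrightarrow> radix_digit \<beta> M ?C = 0"
    unfolding add_mod_right_cancel by simp
  also have "\<dots> \<longleftrightarrow> radix_place \<beta> (Suc M) dvd ?C"
    using dvd by (simp add: radix_place_Suc_dvd_iff)
  finally show ?thesis .
qed

lemma phi_option_neq:
  assumes "(X, Y) \<in> subtraction_game (P_mis k) (C_ord \<beta> k)"
  shows "\<phi> \<beta> Y \<noteq> \<phi> \<beta> X"
proof -
  let ?C = "map2 (-) X Y"
  have g: "X \<in> nonzero_tuples k" "Y \<in> nonzero_tuples k" "list_all2 (\<le>) Y X"
    and C: "?C \<in> nonzero_tuples k" "\<And>L. radix_place \<beta> L dvd sum_list ?C \<longleftrightarrow> place_dvd \<beta> L ?C"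
    using assms by (auto simp: subtraction_game_def C_ord_iff)
  \<comment> \<open>\<open>m\<close> is the order of the move; membership in \<open>C_ord\<close>
    passes the failure at \<open>Suc m\<close> on to the total.\<close>
  obtain m where m: "\<And>L. place_dvd \<beta> L ?C \<longleftrightarrow> L \<le> m"
    using ex_last_place_dvd[OF C(1)] by blast
  have "place_dvd \<beta> m ?C" using m[of m] by blast
  moreover have "\<not> radix_place \<beta> (Suc m) dvd sum_list ?C"
    unfolding C(2) m by simp
  ultimately have "radix_digit \<beta> m (\<phi> \<beta> X) \<noteq> radix_digit \<beta> m (\<phi> \<beta> Y)"
    using digit_phi_eq_iff[OF g] by blast
  then show ?thesis by auto
qed

section \<open>Construction of options with a given value\<close>

text \<open>Both orders of the move equal \<open>M\<close>: its place divides every difference,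
  while the differing digit keeps the next place from dividing even their sum.\<close>

lemma option_if_lowest_digit_differs:
  assumes "X \<in> nonzero_tuples k" "Y \<in> nonzero_tuples k" "list_all2 (\<le>) Y X"
    "\<And>j l. j < k \<Longrightarrow> l < M \<Longrightarrow> radix_digit \<beta> l (Y ! j) = radix_digit \<beta> l (X ! j)"
    "radix_digit \<beta> M (\<phi> \<beta> X) \<noteq> radix_digit \<beta> M (\<phi> \<beta> Y)"
  shows "(X, Y) \<in> subtraction_game (P_mis k) (C_ord \<beta> k)"
proof -
  let ?C = "map2 (-) X Y"
  have len: "length X = k" "length Y = k" using assms(1,2) nonzero_tuplesD(1) by blast+
  have M: "place_dvd \<beta> M ?C"
    using assms(4) place_dvd_diff_iff[OF assms(3)] len by simp
  have SM: "\<not> radix_place \<beta> (Suc M) dvd sum_list ?C"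
    using digit_phi_eq_iff[OF assms(1-3) M] assms(5) by blast
  have sum: "radix_place \<beta> L dvd sum_list ?C" if "place_dvd \<beta> L ?C" for L
    using that by (rule dvd_sum_list)
  have "radix_place \<beta> L dvd sum_list ?C \<longleftrightarrow> place_dvd \<beta> L ?C" for L
  proof (cases "L \<le> M")
    case True
    then show ?thesis using place_dvd_antimono[OF True M] sum by blast
  next
    case False
    then have "\<not> radix_place \<beta> L dvd sum_list ?C"
      using SM radix_place_dvd[of "Suc M" L \<beta>] dvd_trans by fastforce
    then show ?thesis using sum by blast
  qed
  moreover have "?C \<in> nonzero_tuples k"
    using SM sum len by (intro nonzero_tuplesI[of _ _ "Suc M"]) auto
  ultimately show ?thesis
    using assms by (simp add: subtraction_game_def C_ord_iff)
qed

text \<open>The tuple \<open>Y\<close> arises by lowering the digits of \<open>X\<close> at position \<open>N\<close> by \<open>d\<close> in total. One of the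
  lowered entries receives the digits of \<open>g\<close> on \<open>[M, N)\<close>, all others receive \<open>0\<close> there. If \<open>d = 0\<close>,
  no entry is lowered at \<open>N\<close>, whence the last assumption.\<close>

lemma ex_tuple_with_digit_sums:
  assumes "length X = k" "0 < k" "M \<le> N" "\<And>L. g L < \<beta> L"
    and outside: "\<And>L. L < M \<or> N < L \<Longrightarrow> g L = digit_sum \<beta> L X mod \<beta> L"
    and d: "d \<le> digit_sum \<beta> N X" "(g N + d) mod \<beta> N = digit_sum \<beta> N X mod \<beta> N"
    and d0: "d = 0 \<Longrightarrow> \<forall>L. M \<le> L \<and> L < N \<longrightarrow> g L = 0"
  obtains Y where "list_all2 (\<le>) Y X" "\<And>L. digit_sum \<beta> L Y mod \<beta> L = g L"
    "\<And>j L. j < k \<Longrightarrow> L < M \<Longrightarrow> radix_digit \<beta> L (Y ! j) = radix_digit \<beta> L (X ! j)"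
    "\<And>j L. j < k \<Longrightarrow> M \<le> L \<Longrightarrow> L < N \<Longrightarrow> g L = 0 \<Longrightarrow> radix_digit \<beta> L (Y ! j) = 0"
proof -
  have ds: "digit_sum \<beta> L Z = (\<Sum>j<k. radix_digit \<beta> L (Z ! j))" if "length Z = k" for L Z
    using that by (simp add: sum_list_sum_nth atLeast0LessThan)
  obtain t where t: "\<And>j. j < k \<Longrightarrow> t j \<le> radix_digit \<beta> N (X ! j)"
      "(\<Sum>j<k. t j) + d = digit_sum \<beta> N X"
    using ex_smaller_summands[of d "\<lambda>j. radix_digit \<beta> N (X ! j)" k] d(1) ds assms(1) by auto
  have "\<exists>i<k. t i < radix_digit \<beta> N (X ! i)" if "0 < d"
  proof (rule ccontr)
    assume "\<not> ?thesis"
    then have "(\<Sum>j<k. t j) = digit_sum \<beta> N X"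
      using t(1) by (simp only: ds[OF assms(1)]) (rule sum.cong, auto simp: le_less)
    with t(2) that show False by simp
  qed
  \<comment> \<open>For \<open>d = 0\<close> any index serves, and \<open>0 < k\<close> supplies
    one.\<close>
  then obtain i where i: "i < k" "0 < d \<Longrightarrow> t i < radix_digit \<beta> N (X ! i)"
    using assms(2) by blast
  define e where "e j L = (if L < M \<or> N < L then radix_digit \<beta> L (X ! j)
    else if L = N then t j else if j = i then g L else 0)" for j L
  have ex: "\<exists>n. \<forall>L. radix_digit \<beta> L n = e j L" if "j < k" for j
  proof (rule ex_radix_digits[where K = "Suc (max N (X ! j))"])
    show "e j L < \<beta> L" for L
      using le_less_trans[OF t(1)[OF that] radix_digit_lt] assms(4)[of L]
        le_less_trans[OF le0 assms(4)[of L]] by (simp add: e_def)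
    show "e j L = 0" if "Suc (max N (X ! j)) \<le> L" for L
      using that base_ge_2 assms(3) by (auto simp: e_def radix_digit_eq_0)
  qed
  define f where "f j = (SOME n. \<forall>L. radix_digit \<beta> L n = e j L)" for j
  have f: "radix_digit \<beta> L (f j) = e j L" if "j < k" for j L
    using someI_ex[OF ex[OF that]] unfolding f_def by blast
  define Y where "Y = map f [0..<k]"
  have Y: "length Y = k" "\<And>j L. j < k \<Longrightarrow> radix_digit \<beta> L (Y ! j) = e j L"
    by (simp_all add: Y_def f)
  show thesis
  proof (rule that[of Y])
    have "Y ! j \<le> X ! j" if "j < k" for j
    \<comment> \<open>Only entry \<open>i\<close> can gain digits below \<open>N\<close>, and a
      strict drop at \<open>N\<close> outweighs them. Otherwise the comparison works digit by digit;
      for \<open>d = 0\<close> this is because \<open>g\<close> vanishes on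
      \<open>[M, N)\<close>.\<close>
    proof (cases "j = i \<and> 0 < d")
      case True
      show ?thesis
      proof (rule less_imp_le, rule radix_less[of N])
        show "radix_digit \<beta> N (Y ! j) < radix_digit \<beta> N (X ! j)"
          unfolding Y(2)[OF that] using True i(2) assms(3) by (simp add: e_def)
        show "radix_digit \<beta> L (Y ! j) = radix_digit \<beta> L (X ! j)" if "N < L" for L
          unfolding Y(2)[OF \<open>j < k\<close>] using that by (simp add: e_def)
      qed
    next
      case False
      show ?thesis
      proof (rule radix_le)
        fix L
        have "g L = 0" if "j = i" "M \<le> L" "L < N"
          using d0 False that by blast
        then show "radix_digit \<beta> L (Y ! j) \<le> radix_digit \<beta> L (X ! j)"
          unfolding Y(2)[OF that] using t(1)[OF that] by (auto simp: e_def)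
      qed
    qed
    then show "list_all2 (\<le>) Y X"
      using assms(1) Y(1) by (simp add: list_all2_conv_all_nth)
    show "digit_sum \<beta> L Y mod \<beta> L = g L" for L
    proof -
      have sum: "digit_sum \<beta> L Y = (\<Sum>j<k. e j L)"
        using ds[OF Y(1)] Y(2) by simp
      consider "L < M \<or> N < L" | "L = N" | "M \<le> L" "L < N" by linarith
      then show ?thesis
      proof cases
        case 1
        then show ?thesis using sum outside[of L] ds[OF assms(1)] by (simp add: e_def)
      next
        case 2
        then have "digit_sum \<beta> L Y + d = digit_sum \<beta> N X"
          using sum t(2) assms(3) by (simp add: e_def)
        then have "(digit_sum \<beta> L Y + d) mod \<beta> L = (g L + d) mod \<beta> L"
          using d(2) 2 by simp
        then have "digit_sum \<beta> L Y mod \<beta> L = g L mod \<beta> L"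
          by (simp only: add_mod_right_cancel)
        then show ?thesis using assms(4)[of L] by simp
      next
        case 3
        then have "(\<Sum>j<k. e j L) = (\<Sum>j<k. if j = i then g L else 0)"
          by (intro sum.cong) (auto simp: e_def)
        then show ?thesis using sum i assms(4)[of L] by simp
      qed
    qed
    show "radix_digit \<beta> L (Y ! j) = radix_digit \<beta> L (X ! j)" if "j < k" "L < M" for j L
      unfolding Y(2)[OF that(1)] using that(2) by (simp add: e_def)
    show "radix_digit \<beta> L (Y ! j) = 0" if "j < k" "M \<le> L" "L < N" "g L = 0" for j L
      unfolding Y(2)[OF that(1)] using that(2-) by (simp add: e_def)
  qed
qed

text \<open>Passing from \<open>h\<close> to \<open>h + 1\<close> raises by 1, modulo the base,
  exactly the digits whose place divides \<open>h + 1\<close>; the offset in \<open>\<phi>\<close>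
  undoes this. The converse of \<open>dvd\<close> follows since vanishing digits give vanishing
  digit sums.\<close>

lemma phi_eq_if_digit_sums_Suc:
  assumes "Y \<in> nonzero_tuples k" "\<And>L. digit_sum \<beta> L Y mod \<beta> L = radix_digit \<beta> L (Suc h)"
    and dvd: "\<And>L. radix_place \<beta> L dvd Suc h \<Longrightarrow> place_dvd \<beta> L Y"
  shows "\<phi> \<beta> Y = h"
proof (rule radix_digit_inject[of \<beta>, OF base_ge_2])
  fix L
  have "radix_place \<beta> L dvd Suc h" if "place_dvd \<beta> L Y"
  proof -
    have "digit_sum \<beta> l Y = 0" if "l < L" for l
      using \<open>place_dvd \<beta> L Y\<close> that by (auto simp: radix_place_dvd_iff sum_list_eq_0_iff)
    then show ?thesis
      unfolding radix_place_dvd_iff assms(2)[symmetric] by (simp del: sum_list_eq_0_iff)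
  qed
  then have iff: "place_dvd \<beta> L Y \<longleftrightarrow> radix_place \<beta> L dvd Suc h"
    using dvd[of L] by (rule iffI)
  have "radix_digit \<beta> L (\<phi> \<beta> Y) =
      (digit_sum \<beta> L Y mod \<beta> L + (if place_dvd \<beta> L Y then \<beta> L - 1 else 0)) mod \<beta> L"
    by (simp only: radix_digit_phi[OF assms(1)] mod_simps)
  also have "\<dots> = radix_digit \<beta> L h"
    unfolding assms(2) iff radix_digit_Suc
    using base_ge_2[of L] radix_digit_lt[of L h] by (auto simp: mod_simps)
  finally show "radix_digit \<beta> L (\<phi> \<beta> Y) = radix_digit \<beta> L h" .
qed

lemma ex_option_with_phi:
  assumes X: "X \<in> nonzero_tuples k" and h: "h < \<phi> \<beta> X"
  shows "\<exists>Y. (X, Y) \<in> subtraction_game (P_mis k) (C_ord \<beta> k) \<and> \<phi> \<beta> Y = h"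
proof -
  let ?S = "\<lambda>L. digit_sum \<beta> L X" and ?h = "\<lambda>L. radix_digit \<beta> L h"
  obtain N where N: "?h N < radix_digit \<beta> N (\<phi> \<beta> X)"
      "\<And>L. N < L \<Longrightarrow> ?h L = radix_digit \<beta> L (\<phi> \<beta> X)"
    using ex_top_difference[OF h] by blast
  define M where "M = (LEAST L. ?h L \<noteq> radix_digit \<beta> L (\<phi> \<beta> X))"
  have M: "?h M \<noteq> radix_digit \<beta> M (\<phi> \<beta> X)"
    unfolding M_def by (rule LeastI[of _ N]) (use N(1) in simp)
  have M_less: "?h L = radix_digit \<beta> L (\<phi> \<beta> X)" if "L < M" for L
    using not_less_Least[OF that[unfolded M_def]] by simp
  have "M \<le> N"
    unfolding M_def by (rule Least_le) (use N(1) in simp)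
  have len: "length X = k" "0 < k" using nonzero_tuplesD[OF X] by auto
  note phi_digit = radix_digit_phi[OF X]
  obtain m where m: "\<And>L. place_dvd \<beta> L X \<longleftrightarrow> L \<le> m"
    using ex_last_place_dvd[OF X] by blast
  show ?thesis
  proof (cases "M \<le> m")
    case False
    \<comment> \<open>Below \<open>M\<close> the tuple \<open>Y\<close> will share the digits of
      \<open>X\<close>, so the digit sums of \<open>X\<close> are kept there and
      \<open>\<phi>\<close> applies the same offset to both.\<close>
    define g where "g L = (if L < M then ?S L mod \<beta> L else ?h L)" for L
    have phi_S: "radix_digit \<beta> L (\<phi> \<beta> X) = ?S L mod \<beta> L" if "M \<le> L" for L
      using False that m[of L] by (simp only: phi_digit) auto
    have glt: "g L < \<beta> L" for L
      using base_ge_2[of L] by (auto simp: g_def)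
    \<comment> \<open>Strictness makes the total decrease at \<open>N\<close> positive, so
      \<open>g\<close> may be nonzero below \<open>N\<close>.\<close>
    have gN: "g N < ?S N mod \<beta> N"
      using N(1) \<open>M \<le> N\<close> phi_S[of N] by (auto simp: g_def)
    obtain Y where Y: "list_all2 (\<le>) Y X" "\<And>L. digit_sum \<beta> L Y mod \<beta> L = g L"
      "\<And>j L. j < k \<Longrightarrow> L < M \<Longrightarrow> radix_digit \<beta> L (Y ! j) = radix_digit \<beta> L (X ! j)"
    proof (rule ex_tuple_with_digit_sums[OF len \<open>M \<le> N\<close> glt])
      show "g L = ?S L mod \<beta> L" if "L < M \<or> N < L" for L
        using that N(2)[of L] phi_S[of L] \<open>M \<le> N\<close> by (auto simp: g_def)
      show "?S N mod \<beta> N - g N \<le> ?S N"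
        by (meson diff_le_self le_trans mod_less_eq_dividend)
      show "(g N + (?S N mod \<beta> N - g N)) mod \<beta> N = ?S N mod \<beta> N"
        using gN by simp
    qed (use gN in auto)
    have lenY: "length Y = k" using Y(1) len by (simp add: list_all2_lengthD)
    have same: "place_dvd \<beta> L X \<longleftrightarrow> place_dvd \<beta> L Y" if "L \<le> M" for L
      using Y(3) len lenY that by (intro place_dvd_cong[of _ _ _ M]) auto
    have notY: "\<not> place_dvd \<beta> L Y" if "M \<le> L" for L
      using same[of M] m[of M] False place_dvd_antimono[OF that] by blast
    have YP: "Y \<in> nonzero_tuples k"
      using nonzero_tuplesI[OF lenY notY[OF order_refl]] .
    have "\<phi> \<beta> Y = h"
    proof (rule radix_digit_inject[of \<beta>, OF base_ge_2])
      fix L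
      have *: "radix_digit \<beta> L (\<phi> \<beta> Y) =
          (g L + (if place_dvd \<beta> L Y then \<beta> L - 1 else 0)) mod \<beta> L"
        unfolding Y(2)[symmetric] by (simp only: radix_digit_phi[OF YP] mod_simps)
      show "radix_digit \<beta> L (\<phi> \<beta> Y) = ?h L"
      proof (cases "L < M")
        case True
        then show ?thesis
          unfolding * M_less[OF True] phi_digit using same[of L] by (simp add: g_def mod_simps)
      next
        case False
        then have "\<not> place_dvd \<beta> L Y" using notY[of L] by simp
        then show ?thesis unfolding * using False by (simp only: if_False g_def) simp
      qed
    qed
    moreover from this have "(X, Y) \<in> subtraction_game (P_mis k) (C_ord \<beta> k)"
      by (intro option_if_lowest_digit_differs[OF X YP Y(1), where M = M]) (use Y(3) M in simp_all)
    ultimately show ?thesis by blast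
  next
    case True
    define g where "g L = radix_digit \<beta> L (Suc h)" for L
    \<comment> \<open>All digits of \<open>X\<close> below \<open>m\<close> vanish, so if \<open>N < m\<close> one has to borrow from position \<open>m\<close>.\<close>
    define N' where "N' = max N m"
    have X0: "radix_digit \<beta> L x = 0" if "x \<in> set X" "L < m" for x L
      using m[of m] that by (auto simp: radix_place_dvd_iff)
    have S0: "?S L = 0" if "L < m" for L
      using X0 that by (simp add: sum_list_eq_0_iff)
    have Sm: "0 < ?S m"
    proof (rule ccontr)
      assume "\<not> ?thesis"
      then have "place_dvd \<beta> (Suc m) X"
        using m[of m] by (auto simp: radix_place_Suc_dvd_iff)
      with m[of "Suc m"] show False by simp
    qed
    have phi_le: "radix_digit \<beta> L (\<phi> \<beta> X) = (?S L + (\<beta> L - 1)) mod \<beta> L" if "L \<le> m" for L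
      using that m[of L] by (simp only: phi_digit) auto
    have phi_gt: "radix_digit \<beta> L (\<phi> \<beta> X) = ?S L mod \<beta> L" if "m < L" for L
      using that m[of L] by (simp only: phi_digit) auto
    have phi_m: "radix_digit \<beta> m (\<phi> \<beta> X) = (?S m - 1) mod \<beta> m"
    proof -
      have "?S m + (\<beta> m - 1) = (?S m - 1) + \<beta> m" using Sm base_ge_2[of m] by linarith
      then show ?thesis using phi_le[of m] by simp
    qed
    \<comment> \<open>The digit of \<open>h\<close> at \<open>N\<close> is not maximal, so the carry
      of \<open>h + 1\<close> stops there at the latest.\<close>
    have "?h N \<noteq> \<beta> N - 1"
      using N(1) radix_digit_lt[of N "\<phi> \<beta> X"] by linarith
    then have nd: "\<not> radix_place \<beta> L dvd Suc h" if "N < L" for L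
      using that by (auto simp: radix_place_dvd_Suc_iff)
    \<comment> \<open>The zero digits of \<open>X\<close> below \<open>m\<close> become maximal
      digits of \<open>\<phi> \<beta> X\<close>, and \<open>h\<close> shares those below
      \<open>M\<close>.\<close>
    have dM: "radix_place \<beta> M dvd Suc h"
      unfolding radix_place_dvd_Suc_iff
    proof (intro allI impI)
      fix l assume "l < M"
      with True have "l < m" by simp
      with phi_le[of l] S0 base_ge_2[of l] have "radix_digit \<beta> l (\<phi> \<beta> X) = \<beta> l - 1" by simp
      with M_less[OF \<open>l < M\<close>] show "?h l = \<beta> l - 1" by simp
    qed
    have g_gt: "g L = radix_digit \<beta> L (\<phi> \<beta> X)" if "N < L" for L
      using nd[OF that] N(2)[OF that] by (simp add: g_def radix_digit_Suc)
    \<comment> \<open>A carry into \<open>N\<close> cannot wrap around, since the digit of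
      \<open>h\<close> there is below another digit.\<close>
    have g_N: "g N = ?h N + (if radix_place \<beta> N dvd Suc h then 1 else 0)"
      using le_less_trans[OF Suc_leI[OF N(1)] radix_digit_lt] by (simp add: g_def radix_digit_Suc)
    have glt: "g L < \<beta> L" for L by (simp add: g_def)
    have g_M: "g L = 0" if "L < M" for L
      using dM that by (auto simp: g_def radix_place_dvd_iff)
    have "M \<le> N'" using True by (simp add: N'_def)
    \<comment> \<open>\<open>d\<close> is the total decrease at \<open>N'\<close>; it must be
      positive unless \<open>g\<close> vanishes on \<open>[M, N')\<close>.\<close>
    have "\<exists>d \<le> ?S N'. (g N' + d) mod \<beta> N' = ?S N' mod \<beta> N' \<and>
      (d = 0 \<longrightarrow> (\<forall>L. M \<le> L \<and> L < N' \<longrightarrow> g L = 0))"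
    proof -
      consider "N < m" | "N = m" | "m < N" by linarith
      then show ?thesis
      proof cases
        \<comment> \<open>At \<open>m\<close> the digit wanted is that of \<open>?S m - 1\<close>,
          so a single unit is borrowed.\<close>
        case 1
        then have "N' = m" "g m = (?S m - 1) mod \<beta> m"
          using g_gt phi_m by (auto simp: N'_def)
        then show ?thesis using Sm by (intro exI[of _ 1]) (simp add: mod_simps Suc_le_eq)
      next
        case 2
        \<comment> \<open>\<open>?r\<close> is the digit of \<open>\<phi> \<beta> X\<close> at
          \<open>m\<close>, so \<open>?r + 1\<close> is congruent to \<open>?S m\<close>; the extra
          1 keeps \<open>d\<close> positive even if \<open>g m = ?r\<close>.\<close>
        let ?r = "(?S m - 1) mod \<beta> m"
        have r: "N' = m" "g m \<le> ?r"
          using 2 N(1) g_N phi_m by (auto simp: N'_def)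
        have "?r \<le> ?S m - 1" by (rule mod_less_eq_dividend)
        then have "?r + 1 - g m \<le> ?S m" using Sm by linarith
        moreover have "(g m + (?r + 1 - g m)) mod \<beta> m = ?S m mod \<beta> m"
        proof -
          have "g m + (?r + 1 - g m) = ?r + 1" using r by linarith
          then show ?thesis using Sm by (simp add: mod_simps)
        qed
        ultimately show ?thesis using r by (intro exI[of _ "?r + 1 - g m"]) auto
      next
        case 3
        have le: "N' = N" "g N \<le> ?S N mod \<beta> N"
          using 3 N(1) g_N phi_gt[of N] by (auto simp: N'_def)
        \<comment> \<open>The decrease is 0 only if the carry of \<open>h + 1\<close> reached
          \<open>N\<close>, and then all digits of \<open>h + 1\<close> below \<open>N\<close> are
          0.\<close>
        have zero: "g L = 0" if "?S N mod \<beta> N - g N = 0" "L < N" for L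
        proof -
          have "radix_place \<beta> N dvd Suc h"
            using that(1) g_N N(1) phi_gt[OF 3] by (auto split: if_splits)
          then show ?thesis using that(2) by (auto simp: g_def radix_place_dvd_iff)
        qed
        have "?S N mod \<beta> N - g N \<le> ?S N"
          by (meson diff_le_self le_trans mod_less_eq_dividend)
        moreover have "(g N + (?S N mod \<beta> N - g N)) mod \<beta> N = ?S N mod \<beta> N"
          using le(2) by simp
        ultimately show ?thesis
          unfolding le(1) using zero by blast
      qed
    qed
    then obtain d where d: "d \<le> ?S N'" "(g N' + d) mod \<beta> N' = ?S N' mod \<beta> N'"
      "d = 0 \<Longrightarrow> \<forall>L. M \<le> L \<and> L < N' \<longrightarrow> g L = 0" by blast
    have out: "g L = ?S L mod \<beta> L" if "L < M \<or> N' < L" for L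
      using that
    proof
      assume "L < M"
      then show ?thesis using g_M[of L] S0[of L] True by (simp del: sum_list_eq_0_iff)
    next
      assume "N' < L"
      then show ?thesis using g_gt[of L] phi_gt[of L] by (simp add: N'_def)
    qed
    obtain Y where Y: "list_all2 (\<le>) Y X" "\<And>L. digit_sum \<beta> L Y mod \<beta> L = g L"
      "\<And>j L. j < k \<Longrightarrow> L < M \<Longrightarrow> radix_digit \<beta> L (Y ! j) = radix_digit \<beta> L (X ! j)"
      "\<And>j L. j < k \<Longrightarrow> M \<le> L \<Longrightarrow> L < N' \<Longrightarrow> g L = 0 \<Longrightarrow> radix_digit \<beta> L (Y ! j) = 0"
      by (rule ex_tuple_with_digit_sums[OF len \<open>M \<le> N'\<close> glt out d]) blast+
    have lenY: "length Y = k" using Y(1) len by (simp add: list_all2_lengthD)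
    have YP: "Y \<in> nonzero_tuples k"
    proof -
      have False if "Y = replicate k 0"
      proof -
        have "digit_sum \<beta> L Y = 0" for L
          by (simp add: that sum_list_replicate radix_digit_def)
        then have "radix_digit \<beta> L (Suc h) = radix_digit \<beta> L 0" for L
          using Y(2)[of L] by (simp add: g_def radix_digit_eq_0[OF base_ge_2] del: sum_list_eq_0_iff)
        then have "Suc h = 0"
          by (rule radix_digit_inject[of \<beta>, OF base_ge_2])
        then show False by simp
      qed
      then show ?thesis
        using lenY by (auto simp: nonzero_tuples_def tuples_def)
    qed
    have phiY: "\<phi> \<beta> Y = h"
    proof (rule phi_eq_if_digit_sums_Suc[OF YP])
      show "digit_sum \<beta> L Y mod \<beta> L = radix_digit \<beta> L (Suc h)" for L
        using Y(2) by (simp add: g_def)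
      show "place_dvd \<beta> L Y" if dvd: "radix_place \<beta> L dvd Suc h" for L
      proof -
        have "L \<le> N'" using nd[of L] dvd by (force simp: N'_def)
        \<comment> \<open>Below \<open>M\<close> the digits are those of \<open>X\<close>, which
          vanish because \<open>M \<le> m\<close>; from \<open>M\<close> on, zero digits of
          \<open>g\<close> force them to vanish.\<close>
        have "radix_digit \<beta> l (Y ! j) = 0" if "j < k" "l < L" for j l
        proof (cases "l < M")
          case l: True
          then show ?thesis using Y(3)[OF that(1) l] X0[of "X ! j" l] that(1) True len by simp
        next
          case False
          have "g l = 0" using dvd that by (auto simp: g_def radix_place_dvd_iff)
          then show ?thesis using False Y(4)[OF that(1), of l] that(2) \<open>L \<le> N'\<close> by simp
        qed
        then have "radix_place \<beta> L dvd Y ! j" if "j < k" for j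
          using that by (simp add: radix_place_dvd_iff)
        then show ?thesis using lenY by (simp add: all_set_conv_all_nth)
      qed
    qed
    then have "(X, Y) \<in> subtraction_game (P_mis k) (C_ord \<beta> k)"
      by (intro option_if_lowest_digit_differs[OF X YP Y(1), where M = M]) (use Y(3) M in simp_all)
    with phiY show ?thesis by blast
  qed
qed

section \<open>Sprague-Grundy values\<close>

text \<open>By well-founded induction the options of \<open>X\<close> have their
  \<open>\<phi>\<close> as values; \<open>\<phi> \<beta> X\<close> is not among these but every
  smaller number is, so it is the \<open>mex\<close>.\<close>

lemma sg_C_ord:
  assumes "X \<in> P_mis k"
  shows "sg (subtraction_game (P_mis k) (C_ord \<beta> k)) X = \<phi> \<beta> X"
proof -
  let ?E = "subtraction_game (P_mis k) (C_ord \<beta> k)"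
  have wf: "wf (?E\<inverse>)"
    by (rule wf_subtraction_game) (auto simp: C_ord_def)
  show ?thesis
    using assms
  proof (induction X rule: wf_induct_rule[OF wf])
    case (1 X)
    have "sg ?E ` {Y. (X, Y) \<in> ?E} = \<phi> \<beta> ` {Y. (X, Y) \<in> ?E}"
      using 1 by (intro image_cong) (auto simp: subtraction_game_def)
    moreover have "mex (\<phi> \<beta> ` {Y. (X, Y) \<in> ?E}) = \<phi> \<beta> X"
      unfolding mex_def
    proof (rule Least_equality)
      show "\<phi> \<beta> X \<notin> \<phi> \<beta> ` {Y. (X, Y) \<in> ?E}"
        using phi_option_neq by fastforce
      show "\<phi> \<beta> X \<le> h" if "h \<notin> \<phi> \<beta> ` {Y. (X, Y) \<in> ?E}" for h
        using that ex_option_with_phi[OF 1(2), of h] by (force simp: not_less[symmetric])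
    qed
    ultimately show ?case by (simp add: sg_rec[OF wf, of X])
  qed
qed

end

theorem theorem1:
  fixes \<beta> :: "nat \<Rightarrow> nat" and k :: nat
  assumes "\<And>L. \<beta> L \<ge> 2" and "k \<ge> 1"
  shows "(\<forall>C. C \<subseteq> nonzero_tuples k \<and> saturated \<beta> k (P_mis k) C \<longrightarrow>
             (\<forall>X\<in>P_mis k. sg (subtraction_game (P_mis k) C) X = \<phi> \<beta> X)) \<and>
         (\<forall>X\<in>P_mis k. sg (subtraction_game (P_mis k) (C_ord \<beta> k)) X = \<phi> \<beta> X)"
proof -
  have "sg (subtraction_game (P_mis k) (C_ord \<beta> k)) X = \<phi> \<beta> X" if "X \<in> P_mis k" for X
    using assms(1) that by (rule sg_C_ord)
  then show ?thesis by (auto simp: saturated_def)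
qed

end
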